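(* Let $\mathcal H$ be a separable infinite-dimensional complex Hilbert space with orthonormal basis $\{f_m\}_{m\ge 1}$. Let $k_1=1$ and $k_n=4\cdot 5^{\,n-2}$ for $n\ge 2$. Let $C$ and $Z$ be compact operators on $\mathcal H$ whose matrices with respect to $\{f_m\}$ are simultaneously of the block-tridiagonal form $$ C = \begin{pmatrix} C_1 & A_1 & 0 & \cdots \\ B_1 & C_2 & A_2 & \ddots\\ 0 & B_2 & C_3 & \ddots\\ \vdots & \ddots & \ddots &\ddots\end{pmatrix}, \qquad Z = \begin{pmatrix} Z_1 & X_1 & 0 & \cdots \\ Y_1 & Z_2 & X_2 & \ddots\\ 0 & Y_2 & Z_3 & \ddots\\ \vdots & \ddots & \ddots &\ddots\end{pmatrix}, $$ where $C_n, Z_n$ are $k_n\times k_n$ matrices, $A_n, X_n$ are $k_n\times k_{n+1}$ matrices and $B_n, Y_n$ are $k_{n+1}\times k_n$ matrices. For $n\ge 1$ let $C''_n, Z''_n\in M_{5^{n-1}}(\mathbb C)$ be the upper left $5^{n-1}\times 5^{n-1}$ corners of these matrices (note $k_1+\cdots+k_n=5^{n-1}$), i.e. $$ C''_n =\begin{pmatrix} C_1 & A_1 & 0 &\cdots &0 \\ B_1 & C_2 & A_2 & \ddots & \vdots \\ 0& \ddots & \ddots & \ddots & 0 \\ \vdots & \ddots & B_{n-2} & C_{n-1} & A_{n-1} \\ 0 & \cdots & 0 & B_{n-1} & C_n \end{pmatrix}, \qquad Z''_n = \begin{pmatrix} Z_1 & X_1 & 0 &\cdots &0 \\ Y_1 &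 Z_2 & X_2 & \ddots & \vdots \\ 0& \ddots & \ddots & \ddots & 0 \\ \vdots & \ddots & Y_{n-2} & Z_{n-1} & X_{n-1} \\ 0 & \cdots & 0 & Y_{n-1} & Z_n \end{pmatrix}. $$ If for every $n\ge 1$ the pair $\{C''_n,Z''_n\}$ is simultaneously triangularizable, then the commutator $CZ-ZC$ is quasinilpotent.
   Context: A bounded operator is quasinilpotent if its spectrum is $\{0\}$. A pair of matrices $\{M,N\}$ in $M_d(\mathbb C)$ is simultaneously triangularizable if there is a unitary matrix $U\in M_d(\mathbb C)$ such that $U^*MU$ and $U^*NU$ are both upper triangular (equivalently, there is one invertible matrix conjugating both to upper triangular form). *)

theory Defs
  imports
    "HOL-Analysis.Elementary_Normed_Spaces"
    "Jordan_Normal_Form.Schur_Decomposition"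
begin

section \<open>Complex Hilbert spaces\<close>

text \<open>The inner product is antilinear in its first and linear in its second argument.\<close>

class chilbert_space = banach +
  fixes scaleC :: "complex \<Rightarrow> 'a \<Rightarrow> 'a"
    and cinner :: "'a \<Rightarrow> 'a \<Rightarrow> complex"
  assumes scaleC_add_right: "scaleC a (x + y) = scaleC a x + scaleC a y"
    and scaleC_add_left: "scaleC (a + b) x = scaleC a x + scaleC b x"
    and scaleC_scaleC: "scaleC a (scaleC b x) = scaleC (a * b) x"
    and scaleC_one: "scaleC 1 x = x"
    and scaleR_scaleC: "scaleR r x = scaleC (complex_of_real r) x"
    and cinner_commute: "cinner x y = cnj (cinner y x)"
    and cinner_add_right: "cinner x (y + z) = cinner x y + cinner x z"
    and cinner_scaleC_right: "cinner x (scaleC a y) = a * cinner x y"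
    and cinner_self: "cinner x x = complex_of_real ((norm x)\<^sup>2)"

global_interpretation complex_vs: vector_space "scaleC :: complex \<Rightarrow> 'a \<Rightarrow> 'a::chilbert_space"
  by unfold_locales
    (simp_all add: scaleC_add_right scaleC_add_left scaleC_scaleC scaleC_one)

instantiation complex :: chilbert_space
begin

definition scaleC_complex :: "complex \<Rightarrow> complex \<Rightarrow> complex"
  where "scaleC_complex a x = a * x"

definition cinner_complex :: "complex \<Rightarrow> complex \<Rightarrow> complex"
  where "cinner_complex x y = cnj x * y"

instance
proof
  fix x :: complex
  show "cinner x x = complex_of_real ((norm x)\<^sup>2)"
    by (simp add: cinner_complex_def complex_norm_square mult.commute del: of_real_power)
qed (simp_all add: scaleC_complex_def cinner_complex_def algebra_simps scaleR_conv_of_real)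

end

text \<open>
  The basis is indexed from \<open>0\<close>, so that \<open>f m\<close> is the mathematical \<open>f\<^sub>m\<^sub>+\<^sub>1\<close>; this matches the
  indexing of matrix entries.  A space with such a sequence is automatically separable
  and infinite-dimensional.
\<close>

definition orthonormal_basis :: "(nat \<Rightarrow> 'a::chilbert_space) \<Rightarrow> bool"
  where "orthonormal_basis f \<longleftrightarrow>
    (\<forall>i j. cinner (f i) (f j) = (if i = j then 1 else 0)) \<and>
    closure (complex_vs.span (range f)) = UNIV"

section \<open>Operators\<close>

definition bounded_operator :: "('a::chilbert_space \<Rightarrow> 'a) \<Rightarrow> bool"
  where "bounded_operator T \<longleftrightarrow>
    bounded_linear T \<and> (\<forall>c x. T (scaleC c x) = scaleC c (T x))"

definition compact_operator :: "('a::chilbert_space \<Rightarrow> 'a) \<Rightarrow> bool"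
  where "compact_operator T \<longleftrightarrow>
    bounded_operator T \<and> compact (closure (T ` cball 0 1))"

definition operator_spectrum :: "('a::chilbert_space \<Rightarrow> 'a) \<Rightarrow> complex set"
  where "operator_spectrum T = {c. \<not> (\<exists>S. bounded_operator S \<and>
    (\<forall>x. S (T x - scaleC c x) = x) \<and> (\<forall>x. T (S x) - scaleC c (S x) = x))}"

definition quasinilpotent :: "('a::chilbert_space \<Rightarrow> 'a) \<Rightarrow> bool"
  where "quasinilpotent T \<longleftrightarrow> bounded_operator T \<and> operator_spectrum T = {0}"

section \<open>Simultaneous triangularization\<close>

definition unitary_mat :: "nat \<Rightarrow> complex mat \<Rightarrow> bool"
  where "unitary_mat d U \<longleftrightarrow> U \<in> carrier_mat d d \<and>
    mat_adjoint U * U = 1\<^sub>m d \<and> U * mat_adjoint U = 1\<^sub>m d"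

definition simultaneously_triangularizable :: "nat \<Rightarrow> complex mat \<Rightarrow> complex mat \<Rightarrow> bool"
  where "simultaneously_triangularizable d M N \<longleftrightarrow>
    M \<in> carrier_mat d d \<and> N \<in> carrier_mat d d \<and>
    (\<exists>U. unitary_mat d U \<and>
      upper_triangular (mat_adjoint U * M * U) \<and> upper_triangular (mat_adjoint U * N * U))"

section \<open>Block-tridiagonal form\<close>

text \<open>Blocks are numbered from \<open>1\<close>; the value at \<open>0\<close> is not used.\<close>

definition block_size :: "nat \<Rightarrow> nat"
  where "block_size n = (if n \<le> 1 then 1 else 4 * 5 ^ (n - 2))"

definition block_offset :: "nat \<Rightarrow> nat"
  where "block_offset n = (\<Sum>m = 1..<n. block_size m)"

lemma sum_block_size: "n \<ge> 1 \<Longrightarrow> (\<Sum>m = 1..n. block_size m) = 5 ^ (n - 1)"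
proof (induction n rule: nat_induct_at_least)
  case base
  show ?case by (simp add: block_size_def)
next
  case (Suc n)
  then obtain m where "n = Suc m" by (cases n) auto
  with Suc show ?case by (simp add: block_size_def)
qed

definition matrix_entry :: "(nat \<Rightarrow> 'a::chilbert_space) \<Rightarrow> ('a \<Rightarrow> 'a) \<Rightarrow> nat \<Rightarrow> nat \<Rightarrow> complex"
  where "matrix_entry f T i j = cinner (f i) (T (f j))"

text \<open>
  \<open>D\<close>, \<open>A\<close> and \<open>B\<close> are the diagonal, superdiagonal and subdiagonal blocks: \<open>A p\<close> sits in
  block row \<open>p\<close> and block column \<open>p + 1\<close>, and \<open>B q\<close> in block row \<open>q + 1\<close> and block column \<open>q\<close>.
\<close>

definition block_tridiagonal ::
  "(nat \<Rightarrow> 'a::chilbert_space) \<Rightarrow> ('a \<Rightarrow> 'a) \<Rightarrow>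
    (nat \<Rightarrow> complex mat) \<Rightarrow> (nat \<Rightarrow> complex mat) \<Rightarrow> (nat \<Rightarrow> complex mat) \<Rightarrow> bool"
  where "block_tridiagonal f T D A B \<longleftrightarrow>
    (\<forall>n\<ge>1. D n \<in> carrier_mat (block_size n) (block_size n) \<and>
           A n \<in> carrier_mat (block_size n) (block_size (n + 1)) \<and>
           B n \<in> carrier_mat (block_size (n + 1)) (block_size n)) \<and>
    (\<forall>p\<ge>1. \<forall>q\<ge>1. \<forall>i<block_size p. \<forall>j<block_size q.
       matrix_entry f T (block_offset p + i) (block_offset q + j) =
         (if q = p then D p $$ (i, j)
          else if q = p + 1 then A p $$ (i, j)
          else if p = q + 1 then B q $$ (i, j)
          else 0))"

definition corner :: "(nat \<Rightarrow> 'a::chilbert_space) \<Rightarrow> ('a \<Rightarrow> 'a) \<Rightarrow> nat \<Rightarrow> complex mat"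
  where "corner f T d = mat d d (\<lambda>(i, j). matrix_entry f T i j)"

end

theory Submission
  imports Defs "HOL-Complex_Analysis.Great_Picard"
begin

text \<open>
  Let \<open>P\<^sub>n\<close> be the orthogonal projection onto the span of the first \<open>n\<close> basis vectors and let
  \<open>K = C Z - Z C\<close>.  Compactness makes \<open>P\<^sub>n C\<close> and \<open>P\<^sub>n Z\<close> converge in norm to \<open>C\<close> and \<open>Z\<close>, so the
  truncated commutators \<open>P\<^sub>n C P\<^sub>n Z - P\<^sub>n Z P\<^sub>n C\<close> converge in norm to \<open>K\<close>.  An eigenvector of such
  a truncation for an eigenvalue \<open>c \<noteq> 0\<close> lies in the range of \<open>P\<^sub>n\<close>, and there the truncation acts
  as the commutator of the two \<open>n \<times> n\<close> corners.  When the corners are simultaneously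
  triangularizable, this commutator is similar to a strictly upper triangular matrix and has no
  nonzero eigenvalue.  This applies along the subsequence \<open>n = 5\<^sup>k\<close>.

  It remains to pass to the limit.  In general the spectrum can grow abruptly under norm limits;
  for a bounded operator \<open>T\<close> that is approximated by its truncations \<open>P\<^sub>N T\<close> it cannot, for the following
  reason.  Choose \<open>N\<close> such that \<open>R = T - P\<^sub>N T\<close> has norm at most \<open>r\<close>.  For \<open>\<bar>z\<bar> < 1 / r\<close> the factorization
  \[ I - z T = (I - (z P_N T) (I - z R)^{-1}) (I - z R) \]
  reduces invertibility of \<open>I - z T\<close> to the nonvanishing of the \<open>N \<times> N\<close> determinant
  \[ D_T(z) = \det (\delta_{ij} - z \langle f_i, T (I - z R)^{-1} f_j \rangle), \]
  in which \<open>(I - z R)\<^sup>-\<^sup>1\<close> is a Neumann series.  So \<open>D\<^sub>T\<close> is holomorphic on the disc of radius \<open>1 / r\<close>, it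
  takes the value \<open>1\<close> at \<open>0\<close>, and it depends on \<open>T\<close> continuously, uniformly on compact subsets of the
  disc (\<open>uniform_limit_perturbation_det\<close>).  The determinants of the approximating operators have
  no zeros (\<open>perturbation_det_zero_imp_eigenvector\<close>), so by Hurwitz's theorem \<open>D\<^sub>K\<close> has none either,
  and \<open>K - c\<close> is invertible for every \<open>c\<close> with \<open>\<bar>c\<bar> > r\<close>
  (\<open>limit_no_eigenvalue_imp_notin_spectrum\<close>).  As \<open>r > 0\<close> is arbitrary, the spectrum of \<open>K\<close> contains
  at most \<open>0\<close>; it does contain \<open>0\<close>, because \<open>K\<close> is a norm limit of operators of finite rank on an
  infinite-dimensional space.
\<close>

text \<open>From here on, \<open>$\<close> denotes the entries of the vectors that go with \<open>complex mat\<close>.\<close>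
unbundle no vec_syntax

section \<open>Inner product and norm\<close>

lemma cinner_scaleC_left: "cinner (scaleC a x) y = cnj a * cinner x (y::'a::chilbert_space)"
  by (metis cinner_commute cinner_scaleC_right complex_cnj_mult)

lemma cinner_add_left: "cinner (x + y) z = cinner x z + cinner y (z::'a::chilbert_space)"
  by (metis cinner_commute cinner_add_right complex_cnj_add)

lemma cinner_zero_right [simp]: "cinner x (0::'a::chilbert_space) = 0"
  using cinner_add_right[of x 0 0] by simp

lemma cinner_zero_left [simp]: "cinner (0::'a::chilbert_space) x = 0"
  using cinner_add_left[of 0 0 x] by simp

lemma cinner_minus_right: "cinner x (- y) = - cinner x (y::'a::chilbert_space)"
  using cinner_add_right[of x y "- y"] by (simp add: eq_neg_iff_add_eq_0 add.commute)

lemma cinner_diff_right: "cinner x (y - z) = cinner x y - cinner x (z::'a::chilbert_space)"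
  using cinner_add_right[of x y "- z"] by (simp add: cinner_minus_right)

lemma cinner_sum_right: "cinner x (sum g I) = (\<Sum>i\<in>I. cinner x (g i :: 'a::chilbert_space))"
  by (induction I rule: infinite_finite_induct) (auto simp: cinner_add_right)

lemma cinner_sum_left: "cinner (sum g I) x = (\<Sum>i\<in>I. cinner (g i :: 'a::chilbert_space) x)"
  by (induction I rule: infinite_finite_induct) (auto simp: cinner_add_left)

lemma norm_scaleC: "norm (scaleC a (x::'a::chilbert_space)) = cmod a * norm x"
proof -
  have "complex_of_real ((norm (scaleC a x))\<^sup>2) = complex_of_real ((cmod a * norm x)\<^sup>2)"
    by (simp only: cinner_self[symmetric] cinner_scaleC_left cinner_scaleC_right)
       (simp add: cinner_self complex_norm_square power_mult_distrib mult.assoc[symmetric] mult.commute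
          del: of_real_power flip: of_real_mult complex_norm_square)
  then have "(norm (scaleC a x))\<^sup>2 = (cmod a * norm x)\<^sup>2"
    using of_real_eq_iff by blast
  then show ?thesis
    by (simp add: power2_eq_iff_nonneg)
qed

lemma pythagoras:
  assumes "cinner x (y::'a::chilbert_space) = 0"
  shows "(norm (x + y))\<^sup>2 = (norm x)\<^sup>2 + (norm y)\<^sup>2"
proof -
  have "cinner y x = 0" using assms cinner_commute[of y x] by simp
  then have "complex_of_real ((norm (x + y))\<^sup>2) = complex_of_real ((norm x)\<^sup>2 + (norm y)\<^sup>2)"
    using assms
    by (simp only: cinner_self[symmetric] cinner_add_left cinner_add_right of_real_add) simp
  then show ?thesis using of_real_eq_iff by blast
qed

text \<open>
  The case of the Cauchy-Schwarz inequality in which one vector is a unit vector: \<open>x\<close> is split into its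
  component along \<open>u\<close> and an orthogonal remainder.
\<close>
lemma cinner_unit_le:
  assumes "norm u = 1"
  shows "cmod (cinner u x) \<le> norm (x::'a::chilbert_space)"
proof -
  define p where "p = scaleC (cinner u x) u"
  have "cinner u u = 1" using assms by (simp add: cinner_self)
  then have "cinner p (x - p) = 0"
    by (simp add: p_def cinner_scaleC_left cinner_scaleC_right cinner_diff_right)
  from pythagoras[OF this] have "(norm x)\<^sup>2 = (norm p)\<^sup>2 + (norm (x - p))\<^sup>2" by simp
  then have "(norm p)\<^sup>2 \<le> (norm x)\<^sup>2" by simp
  then have "norm p \<le> norm x" using power2_le_imp_le norm_ge_zero by blast
  then show ?thesis by (simp add: p_def norm_scaleC assms)
qed

section \<open>Bounded operators\<close>

lemma bounded_operatorI:
  assumes "\<And>x y. T (x + y) = T x + T y" and "\<And>c x. T (scaleC c x) = scaleC c (T x)"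
    and "\<And>x. norm (T x) \<le> B * norm (x::'a::chilbert_space)"
  shows "bounded_operator T"
  unfolding bounded_operator_def
  using assms by (auto intro!: bounded_linear_intro[where K = B] simp: scaleR_scaleC mult.commute)

lemma bounded_operator_linear: "bounded_operator T \<Longrightarrow> bounded_linear T"
  and bounded_operator_scaleC: "bounded_operator T \<Longrightarrow> T (scaleC c x) = scaleC c (T x)"
  by (auto simp: bounded_operator_def)

lemma bounded_operator_bound:
  assumes "bounded_operator T"
  obtains B where "B > 0" "\<And>x. norm (T x) \<le> B * norm x"
  using bounded_linear.pos_bounded[OF bounded_operator_linear[OF assms]]
  by (metis mult.commute)

lemmas bounded_operator_simps =
  bounded_operator_scaleC
  linear_add[OF bounded_linear.linear[OF bounded_operator_linear]]
  linear_diff[OF bounded_linear.linear[OF bounded_operator_linear]]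
  linear_sum[OF bounded_linear.linear[OF bounded_operator_linear]]
  linear_0[OF bounded_linear.linear[OF bounded_operator_linear]]

lemma bounded_linear_scaleC: "bounded_linear (scaleC a :: 'a::chilbert_space \<Rightarrow> 'a)"
  by (rule bounded_linear_intro[where K = "cmod a"])
     (auto simp: scaleC_add_right scaleR_scaleC scaleC_scaleC norm_scaleC mult.commute)

lemma bounded_operator_compose:
  "bounded_operator S \<Longrightarrow> bounded_operator T \<Longrightarrow> bounded_operator (\<lambda>x. S (T x))"
  by (auto simp: bounded_operator_def intro: bounded_linear_compose)

lemma bounded_operator_add:
  "bounded_operator S \<Longrightarrow> bounded_operator T \<Longrightarrow> bounded_operator (\<lambda>x. S x + T x)"
  by (auto simp: bounded_operator_def scaleC_add_right intro: bounded_linear_add)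

lemma bounded_operator_diff:
  "bounded_operator S \<Longrightarrow> bounded_operator T \<Longrightarrow> bounded_operator (\<lambda>x. S x - T x)"
  by (auto simp: bounded_operator_def complex_vs.scale_right_diff_distrib intro: bounded_linear_sub)

lemma bounded_operator_scale:
  "bounded_operator T \<Longrightarrow> bounded_operator (\<lambda>x. scaleC a (T x))"
  by (auto simp: bounded_operator_def scaleC_scaleC mult.commute
      intro: bounded_linear_compose[OF bounded_linear_scaleC])

lemma bounded_operator_ident: "bounded_operator (\<lambda>x. x)"
  by (rule bounded_operatorI[where B = 1]) auto

lemma bounded_operator_sum:
  assumes "\<And>i. i \<in> I \<Longrightarrow> bounded_operator (T i)"
  shows "bounded_operator (\<lambda>x. \<Sum>i\<in>I. T i (x::'a::chilbert_space))"
  using assms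
  by (induction I rule: infinite_finite_induct)
     (auto intro: bounded_operator_add bounded_operatorI[where B = 0])

text \<open>
  Finite sums of these operators provide the projections below and the finite-rank correction in
  the inverse of \<open>I - z T\<close>.
\<close>
lemma bounded_operator_rank_one:
  assumes "norm u = 1"
  shows "bounded_operator (\<lambda>x. scaleC (cinner u x) (v::'a::chilbert_space))"
proof (rule bounded_operatorI[where B = "norm v"])
  show "norm (scaleC (cinner u x) v) \<le> norm v * norm x" for x
    using mult_left_mono[OF cinner_unit_le[OF assms, of x] norm_ge_zero[of v]]
    by (simp add: norm_scaleC mult.commute)
qed (auto simp: cinner_add_right scaleC_add_left cinner_scaleC_right scaleC_scaleC)

section \<open>Projections onto leading basis vectors\<close>

definition proj :: "(nat \<Rightarrow> 'a::chilbert_space) \<Rightarrow> nat \<Rightarrow> 'a \<Rightarrow> 'a"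
  where "proj f n x = (\<Sum>i<n. scaleC (cinner (f i) x) (f i))"

context
  fixes f :: "nat \<Rightarrow> 'a::chilbert_space"
  assumes onb: "orthonormal_basis f"
begin

lemma cinner_basis: "cinner (f i) (f j) = (if i = j then 1 else 0)"
  using onb by (auto simp: orthonormal_basis_def)

lemma norm_basis: "norm (f i) = 1"
proof -
  have "complex_of_real ((norm (f i))\<^sup>2) = 1"
    by (simp only: cinner_self[symmetric] cinner_basis) simp
  then have "(norm (f i))\<^sup>2 = 1" using of_real_eq_1_iff by blast
  then show ?thesis by (simp add: power2_eq_1_iff) (smt (verit) norm_ge_zero)
qed

lemma cinner_basis_sum:
  "cinner (f i) (\<Sum>j<n. scaleC (w j) (f j)) = (if i < n then w i else 0)"
  by (simp add: cinner_sum_right cinner_scaleC_right cinner_basis if_distrib[of "\<lambda>c. _ * c"]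
      cong: if_cong)

lemma cinner_basis_proj: "cinner (f i) (proj f n x) = (if i < n then cinner (f i) x else 0)"
  unfolding proj_def by (rule cinner_basis_sum)

lemma bounded_operator_proj: "bounded_operator (proj f n)"
  unfolding proj_def
  by (intro bounded_operator_sum bounded_operator_rank_one norm_basis)

lemma norm_proj_pythagoras: "(norm x)\<^sup>2 = (norm (proj f n x))\<^sup>2 + (norm (x - proj f n x))\<^sup>2"
proof -
  have "cinner (proj f n x) (x - proj f n x) = 0"
    by (subst (1) proj_def)
       (simp add: cinner_sum_left cinner_scaleC_left cinner_diff_right cinner_basis_proj)
  from pythagoras[OF this] show ?thesis by simp
qed

lemma norm_proj_le: "norm (proj f n x) \<le> norm x"
  using norm_proj_pythagoras[of x n] by (auto intro: power2_le_imp_le)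

lemma norm_diff_proj_le: "norm (x - proj f n x) \<le> norm x"
  using norm_proj_pythagoras[of x n] by (auto intro: power2_le_imp_le)

lemma proj_proj: "m \<le> n \<Longrightarrow> proj f n (proj f m x) = proj f m x"
  by (subst (1 3) proj_def, rule sum.mono_neutral_cong_right) (auto simp: cinner_basis_proj)

lemma proj_span:
  assumes "y \<in> complex_vs.span (range f)"
  shows "\<exists>m. \<forall>n\<ge>m. proj f n y = y"
  using assms
proof (induction rule: complex_vs.span_induct_alt)
  case base
  then show ?case using bounded_operator_proj by (auto simp: bounded_operator_simps)
next
  case (step c x y)
  then obtain i m where "x = f i" "\<forall>n\<ge>m. proj f n y = y" by auto
  moreover have "proj f n (f i) = f i" if "n > i" for n
    using that by (simp add: proj_def cinner_basis if_distrib[of "\<lambda>c. scaleC c _"] cong: if_cong)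
  ultimately show ?case
    using bounded_operator_proj
    by (intro exI[of _ "max m (Suc i)"]) (auto simp: bounded_operator_simps)
qed

text \<open>
  On the dense span of the basis the projections are eventually the identity, and \<open>I - P\<^sub>n\<close> is a
  contraction, so the convergence extends to the closure.
\<close>
lemma proj_approx:
  assumes "e > 0"
  shows "\<exists>m. \<forall>n\<ge>m. norm (x - proj f n x) < e"
proof -
  have "x \<in> closure (complex_vs.span (range f))" using onb by (simp add: orthonormal_basis_def)
  then obtain y where y: "y \<in> complex_vs.span (range f)" "dist y x < e"
    using assms closure_approachable by blast
  obtain m where m: "\<forall>n\<ge>m. proj f n y = y" using proj_span[OF y(1)] by auto
  have "norm (x - proj f n x) < e" if "n \<ge> m" for n
  proof -
    have "x - proj f n x = (x - y) - proj f n (x - y)"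
      using m that bounded_operator_proj by (simp add: bounded_operator_simps)
    also have "norm \<dots> \<le> norm (x - y)" by (rule norm_diff_proj_le)
    finally show ?thesis using y(2) by (simp add: dist_norm norm_minus_commute)
  qed
  then show ?thesis by auto
qed

text \<open>
  The projections are contractions that converge pointwise to the identity, hence uniformly on
  the relatively compact image of the unit ball.
\<close>
lemma compact_operator_proj_approx:
  assumes "compact_operator T" and "e > 0"
  shows "\<exists>m. \<forall>n\<ge>m. \<forall>x. norm (T x - proj f n (T x)) \<le> e * norm x"
proof -
  have bT: "bounded_operator T" and cT: "compact (closure (T ` cball 0 1))"
    using assms(1) by (auto simp: compact_operator_def)
  define Q where "Q = closure (T ` cball 0 1)"
  obtain k where k: "finite k" "Q \<subseteq> (\<Union>y\<in>k. ball y (e/2))"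
    using compactE_image[OF cT, of "closure (T ` cball 0 1)" "\<lambda>y. ball y (e/2)"] assms(2)
    unfolding Q_def by (metis (no_types, lifting) UN_iff centre_in_ball half_gt_zero open_ball subsetI)
  have "\<exists>m. \<forall>y. \<forall>n\<ge>m y. norm (y - proj f n y) < e/2"
    using proj_approx[of "e/2"] assms(2) by (intro choice) auto
  then obtain m where m: "\<And>y n. n \<ge> m y \<Longrightarrow> norm (y - proj f n y) < e/2" by blast
  define M where "M = Max (insert 0 (m ` k))"
  have unit: "norm (u - proj f n u) \<le> e" if "u \<in> Q" "n \<ge> M" for u n
  proof -
    obtain y where y: "y \<in> k" "dist y u < e/2" using k(2) \<open>u \<in> Q\<close> by auto
    have "m y \<le> n" using \<open>n \<ge> M\<close> y(1) k(1) unfolding M_def by auto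
    have "u - proj f n u = ((u - y) - proj f n (u - y)) + (y - proj f n y)"
      using bounded_operator_proj by (simp add: bounded_operator_simps)
    also have "norm \<dots> \<le> norm (u - y) + norm (y - proj f n y)"
      by (meson norm_triangle_le norm_diff_proj_le add_right_mono)
    also have "\<dots> \<le> e"
      using y(2) m[OF \<open>m y \<le> n\<close>] by (simp add: dist_norm norm_minus_commute)
    finally show ?thesis .
  qed
  have "norm (T x - proj f n (T x)) \<le> e * norm x" if "n \<ge> M" for n x
  proof (cases "x = 0")
    case True
    then show ?thesis using bT bounded_operator_proj by (simp add: bounded_operator_simps)
  next
    case False
    define a where "a = complex_of_real (1 / norm x)"
    have a: "cmod a = 1 / norm x"
      unfolding a_def norm_of_real by simp
    have "norm (scaleC a x) = 1" using False by (simp add: norm_scaleC a)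
    then have "T (scaleC a x) \<in> Q" unfolding Q_def by (intro subsetD[OF closure_subset]) auto
    from unit[OF this that]
    have "norm (scaleC a (T x - proj f n (T x))) \<le> e"
      using bT bounded_operator_proj by (simp add: bounded_operator_simps complex_vs.scale_right_diff_distrib)
    then show ?thesis using False unfolding norm_scaleC a by (simp add: field_simps)
  qed
  then show ?thesis by auto
qed

end

section \<open>Neumann series\<close>

definition neumann :: "('a::chilbert_space \<Rightarrow> 'a) \<Rightarrow> complex \<Rightarrow> 'a \<Rightarrow> 'a"
  where "neumann R z y = (\<Sum>k. scaleC (z ^ k) ((R ^^ k) y))"

context
  fixes R :: "'a::chilbert_space \<Rightarrow> 'a" and r :: real and z :: complex
  assumes R: "bounded_operator R" and R_le: "\<And>x. norm (R x) \<le> r * norm x"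
    and r: "r \<ge> 0" and rz: "cmod z * r < 1"
begin

lemma norm_funpow_le: "norm ((R ^^ k) y) \<le> r ^ k * norm y"
proof (induction k)
  case (Suc k)
  have "norm ((R ^^ Suc k) y) \<le> r * norm ((R ^^ k) y)" using R_le by simp
  also have "\<dots> \<le> r * (r ^ k * norm y)" using Suc r by (rule mult_left_mono)
  finally show ?case by (simp add: mult.assoc)
qed simp

lemma summable_neumann: "summable (\<lambda>k. scaleC (z ^ k) ((R ^^ k) y))"
proof (rule summable_comparison_test')
  show "summable (\<lambda>k. (cmod z * r) ^ k * norm y)"
    using r rz by (intro summable_mult2 summable_geometric) simp
  show "norm (scaleC (z ^ k) ((R ^^ k) y)) \<le> (cmod z * r) ^ k * norm y" for k
    using mult_left_mono[OF norm_funpow_le[of k y], of "cmod z ^ k"]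
    by (simp add: norm_scaleC norm_power power_mult_distrib mult.assoc)
qed

lemma neumann_solves: "neumann R z y - scaleC z (R (neumann R z y)) = y"
proof -
  let ?a = "\<lambda>k. scaleC (z ^ k) ((R ^^ k) y)"
  have lin: "bounded_linear (\<lambda>x. scaleC z (R x))"
    using bounded_operator_linear[OF bounded_operator_scale[OF R]] .
  have "scaleC z (R (neumann R z y)) = (\<Sum>k. scaleC z (R (?a k)))"
    unfolding neumann_def by (rule bounded_linear.suminf[OF lin summable_neumann])
  also have "\<dots> = (\<Sum>k. ?a (Suc k))"
    by (simp add: bounded_operator_simps(1)[OF R] scaleC_scaleC)
  also have "\<dots> = neumann R z y - y"
    unfolding neumann_def
    using suminf_split_head[OF summable_neumann, of y] by (simp add: scaleC_one)
  finally show ?thesis by simp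
qed

text \<open>
  This bound gives uniqueness of the solution of \<open>x - z R x = y\<close>, and with it the linearity
  and the norm bound of the Neumann series as a function of \<open>y\<close>.
\<close>
lemma resolvent_lower_bound: "(1 - cmod z * r) * norm x \<le> norm (x - scaleC z (R x))"
proof -
  have "norm (scaleC z (R x)) \<le> cmod z * (r * norm x)"
    unfolding norm_scaleC by (intro mult_left_mono R_le) simp
  moreover have "norm x \<le> norm (x - scaleC z (R x)) + norm (scaleC z (R x))"
    using norm_triangle_ineq[of "x - scaleC z (R x)" "scaleC z (R x)"] by simp
  ultimately show ?thesis by (simp add: algebra_simps)
qed

lemma norm_neumann_le: "norm (neumann R z y) \<le> norm y / (1 - cmod z * r)"
  using resolvent_lower_bound[of "neumann R z y"] rz
  by (simp add: neumann_solves field_simps)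

lemma neumann_unique:
  assumes "x - scaleC z (R x) = y"
  shows "x = neumann R z y"
proof -
  let ?d = "x - neumann R z y"
  have "?d - scaleC z (R ?d) = (x - scaleC z (R x)) - (neumann R z y - scaleC z (R (neumann R z y)))"
    by (simp add: bounded_operator_simps[OF R] complex_vs.scale_right_diff_distrib)
  then have "?d - scaleC z (R ?d) = 0" using assms neumann_solves by simp
  then have "(1 - cmod z * r) * norm ?d \<le> 0" using resolvent_lower_bound[of ?d] by simp
  then show ?thesis using rz by (simp add: mult_le_0_iff)
qed

lemma bounded_operator_neumann: "bounded_operator (neumann R z)"
proof (rule bounded_operatorI[where B = "1 / (1 - cmod z * r)"])
  show "neumann R z (x + y) = neumann R z x + neumann R z y" for x y
  proof (rule neumann_unique[symmetric])
    have "neumann R z x + neumann R z y - scaleC z (R (neumann R z x + neumann R z y)) =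
        (neumann R z x - scaleC z (R (neumann R z x))) + (neumann R z y - scaleC z (R (neumann R z y)))"
      by (simp add: bounded_operator_simps[OF R] scaleC_add_right)
    then show "neumann R z x + neumann R z y - scaleC z (R (neumann R z x + neumann R z y)) = x + y"
      by (simp only: neumann_solves)
  qed
  show "neumann R z (scaleC c x) = scaleC c (neumann R z x)" for c x
  proof (rule neumann_unique[symmetric])
    have "scaleC c (neumann R z x) - scaleC z (R (scaleC c (neumann R z x))) =
        scaleC c (neumann R z x - scaleC z (R (neumann R z x)))"
      by (simp add: bounded_operator_simps[OF R] complex_vs.scale_right_diff_distrib scaleC_scaleC mult.commute)
    then show "scaleC c (neumann R z x) - scaleC z (R (scaleC c (neumann R z x))) = scaleC c x"
      by (simp add: neumann_solves)
  qed
qed (use norm_neumann_le in simp)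

text \<open>
  Each matrix coefficient of the Neumann series is a power series in \<open>z\<close>; this is where
  holomorphy of the perturbation determinant comes from.
\<close>
lemma neumann_coefficient_sums:
  assumes "bounded_operator T" and "norm u = 1"
  shows "(\<lambda>k. cinner u (T ((R ^^ k) y)) * z ^ k) sums cinner u (T (neumann R z y))"
proof -
  have lin: "bounded_linear (\<lambda>x. cinner u (T x))"
  proof -
    obtain B where B: "\<And>x. norm (T x) \<le> B * norm x" using bounded_operator_bound[OF assms(1)] by blast
    show ?thesis
    proof (rule bounded_linear_intro[where K = B])
      show "norm (cinner u (T x)) \<le> norm x * B" for x
        using cinner_unit_le[OF assms(2), of "T x"] B[of x] by (simp add: mult.commute)
    qed (simp_all add: scaleR_scaleC bounded_operator_simps[OF assms(1)] cinner_add_right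
        cinner_scaleC_right scaleC_complex_def mult.commute)
  qed
  from bounded_linear.sums[OF lin summable_sums[OF summable_neumann]]
  show ?thesis
    by (simp add: neumann_def bounded_operator_simps(1)[OF assms(1)] cinner_scaleC_right mult.commute)
qed

end

section \<open>The perturbation determinant\<close>

definition tail :: "(nat \<Rightarrow> 'a::chilbert_space) \<Rightarrow> nat \<Rightarrow> ('a \<Rightarrow> 'a) \<Rightarrow> 'a \<Rightarrow> 'a"
  where "tail f N T x = T x - proj f N (T x)"

lemma bounded_operator_tail:
  assumes "orthonormal_basis f" and "bounded_operator T"
  shows "bounded_operator (tail f N T)"
  unfolding tail_def
  by (intro bounded_operator_diff assms
      bounded_operator_compose[OF bounded_operator_proj[OF assms(1)] assms(2)])

definition reduced_entry ::
    "(nat \<Rightarrow> 'a::chilbert_space) \<Rightarrow> nat \<Rightarrow> ('a \<Rightarrow> 'a) \<Rightarrow> nat \<Rightarrow> nat \<Rightarrow> complex \<Rightarrow> complex"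
  where "reduced_entry f N T i j z = cinner (f i) (T (neumann (tail f N T) z (f j)))"

text \<open>
  The equation \<open>x - z T x = y\<close> is equivalent to \<open>x = (I - z R)\<^sup>-\<^sup>1 (y + z w)\<close> with \<open>R = tail f N T\<close> and
  \<open>w = P\<^sub>N T x\<close>.  Applying \<open>P\<^sub>N T\<close> to both sides leaves an \<open>N \<times> N\<close> linear system for the
  coordinates of \<open>w\<close>.  This is the matrix of that system.
\<close>
definition reduced_mat ::
    "(nat \<Rightarrow> 'a::chilbert_space) \<Rightarrow> nat \<Rightarrow> ('a \<Rightarrow> 'a) \<Rightarrow> complex \<Rightarrow> complex mat"
  where "reduced_mat f N T z =
    mat N N (\<lambda>(i, j). (if i = j then 1 else 0) - z * reduced_entry f N T i j z)"

definition perturbation_det ::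
    "(nat \<Rightarrow> 'a::chilbert_space) \<Rightarrow> nat \<Rightarrow> ('a \<Rightarrow> 'a) \<Rightarrow> complex \<Rightarrow> complex"
  where "perturbation_det f N T z = Determinant.det (reduced_mat f N T z)"

text \<open>
  The Leibniz formula, in the form in which holomorphy and uniform convergence pass from the entries
  to the determinant.
\<close>
lemma perturbation_det_expand:
  "perturbation_det f N T z = (\<Sum>p\<in>{p. p permutes {0..<N}}. signof p *
     (\<Prod>i\<in>{0..<N}. (if i = p i then 1 else 0) - z * reduced_entry f N T i (p i) z))"
  unfolding perturbation_det_def reduced_mat_def
  by (subst det_def'[of _ N])
     (auto intro!: sum.cong prod.cong simp: permutes_in_image)

lemma perturbation_det_0: "perturbation_det f N T 0 = 1"
proof -
  have "reduced_mat f N T 0 = 1\<^sub>m N"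
    by (rule eq_matI) (auto simp: reduced_mat_def)
  then show ?thesis by (simp add: perturbation_det_def)
qed

lemma reduced_mat_mult_vec:
  assumes "i < N" "v \<in> carrier_vec N"
  shows "(reduced_mat f N T z *\<^sub>v v) $ i = v $ i - z * (\<Sum>j<N. reduced_entry f N T i j z * v $ j)"
proof -
  have "(reduced_mat f N T z *\<^sub>v v) $ i =
      (\<Sum>j\<in>{0..<N}. (if i = j then v $ j else 0) - z * (reduced_entry f N T i j z * v $ j))"
    using assms
    by (auto simp: reduced_mat_def scalar_prod_def algebra_simps intro!: sum.cong)
  also have "\<dots> = v $ i - z * (\<Sum>j<N. reduced_entry f N T i j z * v $ j)"
    using assms(1) by (simp add: sum_subtractf sum_distrib_left atLeast0LessThan)
  finally show ?thesis .
qed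

context
  fixes f :: "nat \<Rightarrow> 'a::chilbert_space"
    and N :: nat and T :: "'a \<Rightarrow> 'a" and r :: real
  assumes onb: "orthonormal_basis f"
    and T: "bounded_operator T"
    and tail_le: "\<And>x. norm (tail f N T x) \<le> r * norm x"
    and r: "r > 0"
begin

lemma holomorphic_reduced_entry:
  "reduced_entry f N T i j holomorphic_on ball 0 (1 / r)"
proof (rule power_series_holomorphic)
  fix w :: complex assume "w \<in> ball 0 (1 / r)"
  then have "cmod w * r < 1" using r by (simp add: field_simps)
  from neumann_coefficient_sums[OF bounded_operator_tail[OF onb T] tail_le _ this T norm_basis[OF onb]] r
  show "(\<lambda>k. cinner (f i) (T ((tail f N T ^^ k) (f j))) * (w - 0) ^ k)
      sums reduced_entry f N T i j w"
    by (simp add: reduced_entry_def)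
qed

lemma holomorphic_perturbation_det:
  "perturbation_det f N T holomorphic_on ball 0 (1 / r)"
  unfolding perturbation_det_expand[abs_def]
  by (intro holomorphic_intros holomorphic_reduced_entry)

context
  fixes z :: complex
  assumes rz: "cmod z * r < 1"
begin

lemma tail_neumann_solves:
  "neumann (tail f N T) z y - scaleC z (tail f N T (neumann (tail f N T) z y)) = y"
  using neumann_solves[OF bounded_operator_tail[OF onb T] tail_le _ rz] r by simp

lemma tail_neumann_unique:
  "x - scaleC z (tail f N T x) = y \<Longrightarrow> x = neumann (tail f N T) z y"
  using neumann_unique[OF bounded_operator_tail[OF onb T] tail_le less_imp_le[OF r] rz] .

lemma bounded_operator_tail_neumann: "bounded_operator (neumann (tail f N T) z)"
  using bounded_operator_neumann[OF bounded_operator_tail[OF onb T] tail_le _ rz] r by simp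

lemma resolvent_split:
  "x - scaleC z (T x) = (x - scaleC z (tail f N T x)) - scaleC z (proj f N (T x))"
  by (simp add: tail_def complex_vs.scale_right_diff_distrib)

lemma cinner_neumann_combination:
  "cinner (f i) (T (neumann (tail f N T) z (\<Sum>j<N. scaleC (w j) (f j)))) =
    (\<Sum>j<N. reduced_entry f N T i j z * w j)"
  by (simp add: reduced_entry_def bounded_operator_simps[OF bounded_operator_tail_neumann]
      bounded_operator_simps[OF T] cinner_sum_right cinner_scaleC_right mult.commute)

text \<open>
  A vector \<open>v\<close> in the kernel of the reduced matrix is the coordinate vector of some \<open>w\<close> with
  \<open>w = z P\<^sub>N T x\<close>, where \<open>x = (I - z R)\<^sup>-\<^sup>1 w\<close>; so \<open>x = z R x + w = z T x\<close>.
\<close>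
lemma perturbation_det_zero_imp_eigenvector:
  assumes "perturbation_det f N T z = 0"
  shows "\<exists>x. x \<noteq> 0 \<and> x = scaleC z (T x)"
proof -
  have car: "reduced_mat f N T z \<in> carrier_mat N N" by (simp add: reduced_mat_def)
  from assms obtain v where v: "v \<in> carrier_vec N" "v \<noteq> 0\<^sub>v N"
      "reduced_mat f N T z *\<^sub>v v = 0\<^sub>v N"
    unfolding perturbation_det_def det_0_iff_vec_prod_zero[OF car] by blast
  define w where "w = (\<Sum>j<N. scaleC (v $ j) (f j))"
  define x where "x = neumann (tail f N T) z w"
  have coord: "v $ i = z * cinner (f i) (T x)" if "i < N" for i
    using reduced_mat_mult_vec[OF that v(1), of f T z] v(3) that
    unfolding x_def w_def cinner_neumann_combination by simp
  have "w = scaleC z (proj f N (T x))"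
    unfolding w_def proj_def by (simp add: coord complex_vs.scale_sum_right scaleC_scaleC)
  then have "x - scaleC z (T x) = 0"
    unfolding resolvent_split by (simp add: x_def tail_neumann_solves)
  moreover have "x \<noteq> 0"
  proof
    assume "x = 0"
    then have "v $ i = 0" if "i < N" for i
      using coord[OF that] bounded_operator_simps[OF T] by simp
    then have "v = 0\<^sub>v N" using v(1) by (intro eq_vecI) auto
    then show False using v(2) by simp
  qed
  ultimately show ?thesis by auto
qed

text \<open>
  The inverse is \<open>S y = (I - z R)\<^sup>-\<^sup>1 (y + z w)\<close>, where the coordinates of \<open>w\<close> solve the reduced system with
  right-hand side \<open>\<langle>f\<^sub>i, T (I - z R)\<^sup>-\<^sup>1 y\<rangle>\<close>.  They are obtained from the adjugate matrix, which
  makes boundedness of \<open>S\<close> evident.  That \<open>S\<close> is also a left inverse follows from injectivity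
  of \<open>I - z T\<close>: the coordinates of \<open>P\<^sub>N T x\<close> for a vector \<open>x\<close> in its kernel solve the homogeneous
  reduced system.
\<close>
lemma perturbation_det_nonzero_imp_inverse:
  assumes nz: "perturbation_det f N T z \<noteq> 0"
  shows "\<exists>S. bounded_operator S \<and> (\<forall>y. S y - scaleC z (T (S y)) = y) \<and>
    (\<forall>x. S (x - scaleC z (T x)) = x)"
proof -
  let ?G = "neumann (tail f N T) z"
  let ?M = "reduced_mat f N T z"
  define B where "B = (1 / perturbation_det f N T z) \<cdot>\<^sub>m adj_mat ?M"
  have car: "?M \<in> carrier_mat N N" by (simp add: reduced_mat_def)
  have B: "B \<in> carrier_mat N N" using adj_mat(1)[OF car] by (simp add: B_def)
  have MB: "?M * B = 1\<^sub>m N"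
    unfolding B_def mult_smult_distrib[OF car adj_mat(1)[OF car]] adj_mat(2)[OF car]
    using nz by (intro eq_matI) (auto simp: perturbation_det_def)
  define b where "b y = vec N (\<lambda>i. cinner (f i) (T (?G y)))" for y
  have b: "b y \<in> carrier_vec N" for y by (simp add: b_def)
  define w where "w y = (\<Sum>i<N. scaleC ((B *\<^sub>v b y) $ i) (f i))" for y
  define S where "S y = ?G (y + scaleC z (w y))" for y
  have w_sum: "w = (\<lambda>y. \<Sum>i<N. \<Sum>j<N. scaleC (B $$ (i, j)) (scaleC (cinner (f j) (T (?G y))) (f i)))"
    using B by (auto simp: w_def b_def scalar_prod_def scaleC_scaleC complex_vs.scale_sum_left
        atLeast0LessThan intro!: sum.cong)
  have "bounded_operator w"
    unfolding w_sum
    by (intro bounded_operator_sum bounded_operator_scale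
        bounded_operator_compose[OF bounded_operator_rank_one[OF norm_basis[OF onb]]]
        bounded_operator_compose[OF T bounded_operator_tail_neumann])
  then have S: "bounded_operator S"
    unfolding S_def
    by (intro bounded_operator_compose[OF bounded_operator_tail_neumann]
        bounded_operator_add bounded_operator_ident bounded_operator_scale)
  have right: "S y - scaleC z (T (S y)) = y" for y
  proof -
    have "proj f N (T (S y)) = w y"
      unfolding proj_def w_def
    proof (rule sum.cong[OF refl])
      fix i assume "i \<in> {..<N}"
      then have i: "i < N" by simp
      have Bb: "B *\<^sub>v b y \<in> carrier_vec N" using B b by simp
      have "?M *\<^sub>v (B *\<^sub>v b y) = b y"
        using assoc_mult_mat_vec[OF car B b] MB b by simp
      from arg_cong[OF this, of "\<lambda>v. v $ i"]
      have "(B *\<^sub>v b y) $ i = cinner (f i) (T (?G y)) +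
          z * (\<Sum>j<N. reduced_entry f N T i j z * (B *\<^sub>v b y) $ j)"
        unfolding reduced_mat_mult_vec[OF i Bb] using i by (simp add: b_def algebra_simps)
      also have "\<dots> = cinner (f i) (T (S y))"
        unfolding S_def w_def cinner_neumann_combination[symmetric]
        by (simp add: bounded_operator_simps[OF bounded_operator_tail_neumann]
            bounded_operator_simps[OF T] cinner_add_right cinner_scaleC_right)
      finally show "scaleC (cinner (f i) (T (S y))) (f i) = scaleC ((B *\<^sub>v b y) $ i) (f i)" by simp
    qed
    then show ?thesis
      unfolding resolvent_split by (simp add: S_def tail_neumann_solves)
  qed
  have injective: "x = 0" if "x - scaleC z (T x) = 0" for x
  proof -
    define v where "v = vec N (\<lambda>i. cinner (f i) (T x))"
    have v: "v \<in> carrier_vec N" by (simp add: v_def)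
    have proj_v: "proj f N (T x) = (\<Sum>j<N. scaleC (v $ j) (f j))"
      by (simp add: proj_def v_def)
    have x: "x = ?G (scaleC z (proj f N (T x)))"
      using that unfolding resolvent_split by (intro tail_neumann_unique) simp
    have eigen: "v $ i = z * (\<Sum>j<N. reduced_entry f N T i j z * v $ j)" if "i < N" for i
    proof -
      have "v $ i = cinner (f i) (T (?G (scaleC z (proj f N (T x)))))"
        using that x by (simp add: v_def)
      then show ?thesis
        unfolding proj_v cinner_neumann_combination[symmetric]
        by (simp add: bounded_operator_simps(1)[OF bounded_operator_tail_neumann]
            bounded_operator_simps(1)[OF T] cinner_scaleC_right)
    qed
    have "?M *\<^sub>v v = 0\<^sub>v N"
    proof (rule eq_vecI)
      show "(?M *\<^sub>v v) $ i = 0\<^sub>v N $ i" if "i < dim_vec (0\<^sub>v N :: complex Matrix.vec)" for i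
        using that reduced_mat_mult_vec[of i N v f T z, OF _ v] eigen[of i]
        by (simp del: index_mult_mat_vec)
    qed (use car in simp)
    then have "v = 0\<^sub>v N"
      using nz v det_0_iff_vec_prod_zero[OF car] unfolding perturbation_det_def by blast
    then have "proj f N (T x) = 0" unfolding proj_v by simp
    then show "x = 0"
      using x by (simp add: bounded_operator_simps[OF bounded_operator_tail_neumann])
  qed
  have "S (x - scaleC z (T x)) = x" for x
  proof -
    let ?d = "S (x - scaleC z (T x)) - x"
    have "?d - scaleC z (T ?d) =
        (S (x - scaleC z (T x)) - scaleC z (T (S (x - scaleC z (T x))))) - (x - scaleC z (T x))"
      by (simp add: bounded_operator_simps[OF T] complex_vs.scale_right_diff_distrib)
    also have "\<dots> = 0" by (simp only: right) simp
    finally show ?thesis using injective[of ?d] by simp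
  qed
  with S right show ?thesis by blast
qed

end

end

section \<open>Stability under limits of operators without nonzero eigenvalues\<close>

text \<open>
  Convergence in operator norm, with the norm spelled out as a bound on all vectors.
\<close>
definition operator_limit :: "(nat \<Rightarrow> 'a::chilbert_space \<Rightarrow> 'a) \<Rightarrow> ('a \<Rightarrow> 'a) \<Rightarrow> bool"
  where "operator_limit Tn T \<longleftrightarrow> (\<forall>e>0. \<exists>m. \<forall>n\<ge>m. \<forall>x. norm (Tn n x - T x) \<le> e * norm x)"

text \<open>
  With \<open>x = (I - z R)\<^sup>-\<^sup>1 f\<^sub>j\<close> and \<open>x' = (I - z R')\<^sup>-\<^sup>1 f\<^sub>j\<close>, the resolvent identity gives
  \<open>x - x' = (I - z R)\<^sup>-\<^sup>1 z (R - R') x'\<close>, and \<open>q\<close> bounds the norms of both resolvents uniformly for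
  \<open>\<bar>z\<bar> \<le> s\<close>.
\<close>
lemma reduced_entry_diff_le:
  fixes f :: "nat \<Rightarrow> 'a::chilbert_space"
  assumes onb: "orthonormal_basis f"
    and T: "bounded_operator T" and T': "bounded_operator T'"
    and tail: "\<And>x. norm (tail f N T x) \<le> r * norm x"
    and tail': "\<And>x. norm (tail f N T' x) \<le> r * norm x"
    and r: "r > 0"
    and diff: "\<And>x. norm (T x - T' x) \<le> e * norm x" and e: "e \<ge> 0"
    and bound: "\<And>x. norm (T' x) \<le> B * norm x" and B: "B \<ge> 0"
    and z: "cmod z \<le> s" and rs: "s * r < 1"
  defines "q \<equiv> 1 / (1 - s * r)"
  shows "cmod (reduced_entry f N T i j z - reduced_entry f N T' i j z) \<le> e * (q + B * (q * (s * q)))"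
proof -
  let ?R = "tail f N T" and ?R' = "tail f N T'"
  have rz: "cmod z * r < 1" using mult_right_mono[OF z, of r] r rs by linarith
  have s: "s \<ge> 0" using z norm_ge_zero[of z] by linarith
  have q: "q > 0" using rs by (simp add: q_def)
  have zq: "1 / (1 - cmod z * r) \<le> q"
    unfolding q_def using mult_right_mono[OF z, of r] r rs rz by (intro divide_left_mono mult_pos_pos) auto
  note R = bounded_operator_tail[OF onb T, of N] and R' = bounded_operator_tail[OF onb T', of N]
  note solves = tail_neumann_solves[OF onb T tail r rz]
    and solves' = tail_neumann_solves[OF onb T' tail' r rz]
  define x where "x = neumann ?R z (f j)"
  define x' where "x' = neumann ?R' z (f j)"
  have neumann_le: "norm (neumann (tail f N U) z y) \<le> q * norm y"
    if "bounded_operator U" "\<And>x. norm (tail f N U x) \<le> r * norm x" for U y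
  proof -
    have "norm (neumann (tail f N U) z y) \<le> 1 / (1 - cmod z * r) * norm y"
      using norm_neumann_le[OF bounded_operator_tail[OF onb that(1)] that(2) less_imp_le[OF r] rz]
      by simp
    also have "\<dots> \<le> q * norm y" by (intro mult_right_mono zq) simp
    finally show ?thesis .
  qed
  have x: "norm x \<le> q" and x': "norm x' \<le> q"
    using neumann_le[OF T tail, of "f j"] neumann_le[OF T' tail', of "f j"]
    by (simp_all add: x_def x'_def norm_basis[OF onb])
  have "x - x' - scaleC z (?R (x - x')) =
      (x - scaleC z (?R x)) - (x' - scaleC z (?R' x')) + scaleC z (?R x' - ?R' x')"
    by (simp add: bounded_operator_simps[OF R] complex_vs.scale_right_diff_distrib)
  then have "x - x' = neumann ?R z (scaleC z (?R x' - ?R' x'))"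
    using solves[of "f j"] solves'[of "f j"]
    by (intro tail_neumann_unique[OF onb T tail r rz]) (simp add: x_def x'_def)
  then have "norm (x - x') \<le> q * (cmod z * norm (?R x' - ?R' x'))"
    using neumann_le[OF T tail] by (metis norm_scaleC)
  also have "?R x' - ?R' x' = (T x' - T' x') - proj f N (T x' - T' x')"
    by (simp add: tail_def bounded_operator_simps[OF bounded_operator_proj[OF onb]])
  also have "q * (cmod z * norm \<dots>) \<le> q * (s * (e * q))"
  proof (intro mult_left_mono mult_mono z)
    have "norm ((T x' - T' x') - proj f N (T x' - T' x')) \<le> e * norm x'"
      using norm_diff_proj_le[OF onb] diff by (rule order_trans)
    also have "\<dots> \<le> e * q" by (intro mult_left_mono x' e)
    finally show "norm ((T x' - T' x') - proj f N (T x' - T' x')) \<le> e * q" .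
  qed (use q s in auto)
  finally have xx': "norm (x - x') \<le> q * (s * (e * q))" .
  have "reduced_entry f N T i j z - reduced_entry f N T' i j z = cinner (f i) ((T x - T' x) + T' (x - x'))"
    by (simp add: reduced_entry_def x_def x'_def cinner_diff_right bounded_operator_simps[OF T'])
  also have "cmod \<dots> \<le> norm ((T x - T' x) + T' (x - x'))"
    by (rule cinner_unit_le[OF norm_basis[OF onb]])
  also have "\<dots> \<le> e * norm x + B * norm (x - x')"
    by (intro norm_triangle_le add_mono diff bound)
  also have "\<dots> \<le> e * q + B * (q * (s * (e * q)))"
    by (intro add_mono mult_left_mono x xx' e B)
  finally show ?thesis by (simp add: algebra_simps)
qed

lemma uniform_limit_sum:
  fixes F :: "'i \<Rightarrow> nat \<Rightarrow> 'b \<Rightarrow> complex"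
  assumes "\<And>i. i \<in> I \<Longrightarrow> uniform_limit S (F i) (g i) sequentially"
  shows "uniform_limit S (\<lambda>n x. \<Sum>i\<in>I. F i n x) (\<lambda>x. \<Sum>i\<in>I. g i x) sequentially"
  using assms
  by (induction I rule: infinite_finite_induct) (auto intro: uniform_limit_const uniform_limit_add)

text \<open>
  Products of uniformly convergent sequences converge uniformly only when the limits are bounded,
  so boundedness of the product is carried through the induction.
\<close>
lemma uniform_limit_prod_bounded:
  fixes F :: "'i \<Rightarrow> nat \<Rightarrow> 'b \<Rightarrow> complex"
  assumes "\<And>i. i \<in> I \<Longrightarrow> uniform_limit S (F i) (g i) sequentially"
    and "\<And>i. i \<in> I \<Longrightarrow> bounded (g i ` S)"
  shows "uniform_limit S (\<lambda>n x. \<Prod>i\<in>I. F i n x) (\<lambda>x. \<Prod>i\<in>I. g i x) sequentially \<and>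
    bounded ((\<lambda>x. \<Prod>i\<in>I. g i x) ` S)"
  using assms
proof (induction I rule: infinite_finite_induct)
  case (insert i I)
  have "bounded ((\<lambda>x. g i x * (\<Prod>i\<in>I. g i x)) ` S)"
  proof -
    have "bounded (g i ` S)" "bounded ((\<lambda>x. \<Prod>i\<in>I. g i x) ` S)" using insert by auto
    then obtain a b where "\<And>x. x \<in> S \<Longrightarrow> norm (g i x) \<le> a" "\<And>x. x \<in> S \<Longrightarrow> norm (\<Prod>i\<in>I. g i x) \<le> b"
      by (auto simp: bounded_iff)
    then have "norm (g i x * (\<Prod>i\<in>I. g i x)) \<le> a * b" if "x \<in> S" for x
      using that unfolding norm_mult
      by (intro mult_mono) (auto intro: order_trans[OF norm_ge_zero])
    then show ?thesis by (auto simp: bounded_iff)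
  qed
  moreover have "uniform_limit S (\<lambda>n x. F i n x * (\<Prod>i\<in>I. F i n x)) (\<lambda>x. g i x * (\<Prod>i\<in>I. g i x)) sequentially"
    using insert by (intro uniform_lim_mult) auto
  ultimately show ?case using insert.hyps by simp
qed (auto intro: uniform_limit_const simp: bounded_iff intro!: exI[of _ 1])

lemma uniform_limit_perturbation_det:
  fixes f :: "nat \<Rightarrow> 'a::chilbert_space"
  assumes onb: "orthonormal_basis f"
    and T: "bounded_operator T" and Tn: "\<And>n. bounded_operator (Tn n)"
    and tail: "\<And>x. norm (tail f N T x) \<le> r * norm x"
    and tailn: "\<And>n x. norm (tail f N (Tn n) x) \<le> r * norm x"
    and r: "r > 0" and lim: "operator_limit Tn T" and rs: "s * r < 1"
  shows "uniform_limit (cball 0 s) (\<lambda>n. perturbation_det f N (Tn n)) (perturbation_det f N T) sequentially"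
proof (cases "s \<ge> 0")
  case s: True
  obtain B where B: "B > 0" "\<And>x. norm (T x) \<le> B * norm x" using bounded_operator_bound[OF T] by blast
  define q where "q = 1 / (1 - s * r)"
  have q: "q > 0" using rs by (simp add: q_def)
  have entry: "uniform_limit (cball 0 s) (\<lambda>n. reduced_entry f N (Tn n) i j) (reduced_entry f N T i j)
      sequentially" for i j
  proof (rule uniform_limitI)
    fix d :: real assume "d > 0"
    define k where "k = q + B * (q * (s * q))"
    define e where "e = d / (2 * k)"
    have "k > 0" unfolding k_def using q B(1) s by (intro add_pos_nonneg) auto
    then have e: "e > 0" and "e * k < d"
      using \<open>d > 0\<close> by (simp_all add: e_def)
    then have e_less: "e * (q + B * (q * (s * q))) < d" by (simp add: k_def)
    obtain m where m: "\<And>n x. n \<ge> m \<Longrightarrow> norm (Tn n x - T x) \<le> e * norm x"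
      using lim e unfolding operator_limit_def by blast
    have "dist (reduced_entry f N (Tn n) i j z) (reduced_entry f N T i j z) < d"
      if "n \<ge> m" "z \<in> cball 0 s" for n z
      using reduced_entry_diff_le[OF onb Tn T tailn tail r m[OF that(1)] _ B(2) _ _ rs, where z = z and i = i and j = j]
        that(2) e B(1) e_less
      by (simp add: dist_norm q_def)
    then show "\<forall>\<^sub>F n in sequentially. \<forall>z\<in>cball 0 s.
        dist (reduced_entry f N (Tn n) i j z) (reduced_entry f N T i j z) < d"
      unfolding eventually_sequentially by blast
  qed
  have cont: "continuous_on (cball 0 s) (reduced_entry f N T i j)" for i j
  proof (rule continuous_on_subset[OF holomorphic_on_imp_continuous_on])
    show "reduced_entry f N T i j holomorphic_on ball 0 (1 / r)"
      by (rule holomorphic_reduced_entry[OF onb T tail r])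
    have "s < 1 / r" using rs r by (simp add: field_simps)
    then show "cball 0 s \<subseteq> ball 0 (1 / r)" by auto
  qed
  define F where "F p i n z = (if i = p i then 1 else 0) - z * reduced_entry f N (Tn n) i (p i) z" for p i n z
  define g where "g p i z = (if i = p i then 1 else 0) - z * reduced_entry f N T i (p i) z" for p i z
  have bounded: "bounded (h ` cball 0 s)" if "continuous_on (cball 0 s) h" for h :: "complex \<Rightarrow> complex"
    using compact_continuous_image[OF that compact_cball] by (rule compact_imp_bounded)
  have "uniform_limit (cball 0 s) (F p i) (g p i) sequentially" for p i
    unfolding F_def g_def
    by (intro uniform_limit_intros uniform_lim_mult entry bounded cont) (auto intro: continuous_intros)
  moreover have "bounded (g p i ` cball 0 s)" for p i
    unfolding g_def by (intro bounded continuous_intros cont)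
  ultimately have prod: "uniform_limit (cball 0 s) (\<lambda>n z. \<Prod>i\<in>{0..<N}. F p i n z)
      (\<lambda>z. \<Prod>i\<in>{0..<N}. g p i z) sequentially" for p
    by (intro conjunct1[OF uniform_limit_prod_bounded])
  have "uniform_limit (cball 0 s) (\<lambda>n z. \<Sum>p\<in>{p. p permutes {0..<N}}. signof p * (\<Prod>i\<in>{0..<N}. F p i n z))
      (\<lambda>z. \<Sum>p\<in>{p. p permutes {0..<N}}. signof p * (\<Prod>i\<in>{0..<N}. g p i z)) sequentially"
    by (intro uniform_limit_sum bounded_linear.uniform_limit[OF bounded_linear_mult_right] prod)
  then show ?thesis
    by (simp add: perturbation_det_expand[abs_def] F_def g_def)
qed (simp add: uniform_limit_iff)

text \<open>
  With \<open>r = \<bar>c\<bar> / 2\<close> the point \<open>z = 1 / c\<close> lies in the disc of radius \<open>1 / r\<close>, on which all perturbation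
  determinants are defined.  Hurwitz's theorem leaves two cases: the limit determinant has no zeros, or it
  is constant, and then its constant value is its value \<open>1\<close> at the origin.
\<close>
lemma limit_no_eigenvalue_imp_notin_spectrum:
  fixes f :: "nat \<Rightarrow> 'a::chilbert_space"
  assumes onb: "orthonormal_basis f"
    and T: "bounded_operator T" and Tn: "\<And>n. bounded_operator (Tn n)"
    and approx: "\<And>e. e > 0 \<Longrightarrow> \<exists>N. \<forall>x. norm (tail f N T x) \<le> e * norm x"
    and lim: "operator_limit Tn T"
    and no_eig: "\<And>n c x. c \<noteq> 0 \<Longrightarrow> Tn n x = scaleC c x \<Longrightarrow> x = 0"
    and c: "c \<noteq> 0"
  shows "c \<notin> operator_spectrum T"
proof -
  define r where "r = cmod c / 2"
  have r: "r > 0" using c by (simp add: r_def)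
  obtain N where N: "\<And>x. norm (tail f N T x) \<le> (r / 2) * norm x"
    using approx[of "r / 2"] r by auto
  obtain m where m: "\<And>n x. n \<ge> m \<Longrightarrow> norm (Tn n x - T x) \<le> (r / 2) * norm x"
    using lim r unfolding operator_limit_def by (meson half_gt_zero)
  \<comment> \<open>One tail bound \<open>r\<close> has to serve the limit and all approximants: half of it is used up by the tail
    of \<open>T\<close>, the other half by the distance to \<open>T\<close>, which is small from index \<open>m\<close> on.\<close>
  define Vn where "Vn n = Tn (n + m)" for n
  have Vn: "bounded_operator (Vn n)" for n unfolding Vn_def by (rule Tn)
  have limU: "operator_limit Vn T"
    using lim unfolding operator_limit_def Vn_def by (meson trans_le_add1)
  have tail: "norm (tail f N T x) \<le> r * norm x" for x
    by (rule order_trans[OF N mult_right_mono]) (use r in auto)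
  have tailU: "norm (tail f N (Vn n) x) \<le> r * norm x" for n x
  proof -
    have "tail f N (Vn n) x = tail f N T x + ((Vn n x - T x) - proj f N (Vn n x - T x))"
      by (simp add: tail_def bounded_operator_simps[OF bounded_operator_proj[OF onb]])
    also have "norm \<dots> \<le> norm (tail f N T x) + norm (Vn n x - T x)"
      by (intro norm_triangle_le add_left_mono norm_diff_proj_le[OF onb])
    also have "\<dots> \<le> (r / 2) * norm x + (r / 2) * norm x"
      unfolding Vn_def by (intro add_mono N m) simp
    finally show ?thesis by (simp add: field_simps)
  qed
  define z where "z = 1 / c"
  have rz: "cmod z * r < 1" and z: "z \<in> ball 0 (1 / r)"
    using c by (simp_all add: z_def r_def norm_divide divide_strict_right_mono)
  let ?D = "perturbation_det f N T"
  have "?D z \<noteq> 0"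
  proof (cases "?D constant_on ball 0 (1 / r)")
    case True
    then obtain k where k: "\<And>w. w \<in> ball 0 (1 / r) \<Longrightarrow> ?D w = k" by (auto simp: constant_on_def)
    then have "?D z = ?D 0" using z k[of 0] r by simp
    then show ?thesis by (simp add: perturbation_det_0)
  next
    case False
    show ?thesis
    proof (rule Hurwitz_no_zeros[of "ball 0 (1 / r)" "\<lambda>n. perturbation_det f N (Vn n)" ?D])
      show "perturbation_det f N (Vn n) holomorphic_on ball 0 (1 / r)" for n
        by (rule holomorphic_perturbation_det[OF onb Vn tailU r])
      show "?D holomorphic_on ball 0 (1 / r)"
        by (rule holomorphic_perturbation_det[OF onb T tail r])
      show "uniform_limit K (\<lambda>n. perturbation_det f N (Vn n)) ?D sequentially"
        if K: "compact K" "K \<subseteq> ball 0 (1 / r)" for K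
      proof (cases "K = {}")
        case False
        obtain w where w: "w \<in> K" "\<And>y. y \<in> K \<Longrightarrow> cmod y \<le> cmod w"
          using continuous_attains_sup[OF K(1) False, of cmod] by (auto intro: continuous_intros)
        have "cmod w * r < 1" using w(1) K(2) r by (auto simp: field_simps)
        from uniform_limit_perturbation_det[OF onb T Vn tail tailU r limU this]
        show ?thesis by (rule uniform_limit_on_subset) (use w(2) in auto)
      qed (simp add: uniform_limit_iff)
      show "perturbation_det f N (Vn n) w \<noteq> 0" if w: "w \<in> ball 0 (1 / r)" for n w
      proof
        assume zero: "perturbation_det f N (Vn n) w = 0"
        have "cmod w * r < 1" using w r by (simp add: field_simps)
        from perturbation_det_zero_imp_eigenvector[OF onb Vn tailU r this zero]
        obtain x where x: "x \<noteq> 0" "x = scaleC w (Vn n x)" by auto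
        then have "w \<noteq> 0" by auto
        then have "scaleC (1 / w) x = Vn n x"
          by (subst x(2)) (simp add: scaleC_scaleC scaleC_one)
        then show False using no_eig[of "1 / w" "n + m" x] x(1) \<open>w \<noteq> 0\<close> by (simp add: Vn_def)
      qed
    qed (use z False in auto)
  qed
  from perturbation_det_nonzero_imp_inverse[OF onb T tail r rz this]
  obtain S where S: "bounded_operator S" "\<And>y. S y - scaleC z (T (S y)) = y"
      "\<And>x. S (x - scaleC z (T x)) = x" by blast
  have "bounded_operator (\<lambda>y. scaleC (- z) (S y))" by (intro bounded_operator_scale S)
  moreover have "scaleC (- z) (S (T x - scaleC c x)) = x" for x
  proof -
    have "scaleC (- z) (T x - scaleC c x) = x - scaleC z (T x)"
      using c by (simp add: z_def complex_vs.scale_right_diff_distrib scaleC_scaleC scaleC_one)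
    then show ?thesis using S(3)[of x] by (simp flip: bounded_operator_scaleC[OF S(1)])
  qed
  moreover have "T (scaleC (- z) (S x)) - scaleC c (scaleC (- z) (S x)) = x" for x
  proof -
    have "T (scaleC (- z) (S x)) - scaleC c (scaleC (- z) (S x)) = S x - scaleC z (T (S x))"
      using c by (simp only: bounded_operator_scaleC[OF T] scaleC_scaleC)
        (simp add: z_def scaleC_one)
    then show ?thesis using S(2) by simp
  qed
  ultimately show ?thesis unfolding operator_spectrum_def by blast
qed

section \<open>Zero as a point of the spectrum\<close>

text \<open>
  If \<open>T\<close> had a bounded right inverse \<open>S\<close>, then \<open>I - P\<^sub>N = (T - P\<^sub>N T) S\<close> would have norm less
  than \<open>1\<close> for large \<open>N\<close>, although it fixes the basis vector \<open>f N\<close>.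
\<close>
lemma zero_in_operator_spectrum:
  fixes f :: "nat \<Rightarrow> 'a::chilbert_space"
  assumes onb: "orthonormal_basis f" and T: "bounded_operator T"
    and approx: "\<And>e. e > 0 \<Longrightarrow> \<exists>N. \<forall>x. norm (tail f N T x) \<le> e * norm x"
  shows "0 \<in> operator_spectrum T"
proof (rule ccontr)
  assume "0 \<notin> operator_spectrum T"
  then obtain S where S: "bounded_operator S" "\<And>x. T (S x) = x"
    unfolding operator_spectrum_def by auto
  obtain B where B: "B > 0" "\<And>x. norm (S x) \<le> B * norm x" using bounded_operator_bound[OF S(1)] by blast
  obtain N where N: "\<And>x. norm (tail f N T x) \<le> 1 / (2 * B) * norm x"
    using approx[of "1 / (2 * B)"] B(1) by auto
  have "proj f N (f N) = 0" by (simp add: proj_def cinner_basis[OF onb])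
  then have "1 = norm (tail f N T (S (f N)))"
    by (simp add: tail_def S(2) norm_basis[OF onb])
  also have "\<dots> \<le> 1 / (2 * B) * norm (S (f N))" by (rule N)
  also have "\<dots> \<le> 1 / (2 * B) * (B * norm (f N))" using B(1) by (intro mult_left_mono B(2)) simp
  also have "\<dots> < 1" using B(1) by (simp add: norm_basis[OF onb])
  finally show False by simp
qed

section \<open>Commutators of simultaneously triangularizable matrices\<close>

text \<open>
  An upper triangular matrix preserves the vectors that vanish beyond position \<open>i\<close>, and on their entry at
  \<open>i\<close> it acts as its diagonal entry there.  Since diagonal entries commute, a commutator of two such
  matrices annihilates that entry.
\<close>
lemma upper_triangular_mult_vec:
  fixes T :: "complex mat"
  assumes "T \<in> carrier_mat d d" "upper_triangular T" "u \<in> carrier_vec d"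
    and i: "i < d" and zero: "\<And>j. i < j \<Longrightarrow> j < d \<Longrightarrow> u $ j = 0"
  shows "(T *\<^sub>v u) $ i = T $$ (i, i) * u $ i"
    and "i < k \<Longrightarrow> k < d \<Longrightarrow> (T *\<^sub>v u) $ k = 0"
proof -
  have expand: "(T *\<^sub>v u) $ k = (\<Sum>j\<in>{0..<d}. T $$ (k, j) * u $ j)" if "k < d" for k
    using assms(1,3) that by (auto simp: scalar_prod_def)
  have "(\<Sum>j\<in>{0..<d}. T $$ (i, j) * u $ j) = (\<Sum>j\<in>{i}. T $$ (i, j) * u $ j)"
  proof (rule sum.mono_neutral_right)
    show "\<forall>j\<in>{0..<d} - {i}. T $$ (i, j) * u $ j = 0"
    proof
      fix j assume "j \<in> {0..<d} - {i}"
      then consider "j < i" | "i < j" "j < d" by fastforce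
      then show "T $$ (i, j) * u $ j = 0"
        using upper_triangularD[OF assms(2), of j i] assms(1) i zero by cases auto
    qed
  qed (use i in auto)
  then show "(T *\<^sub>v u) $ i = T $$ (i, i) * u $ i" using expand[OF i] by simp
  show "(T *\<^sub>v u) $ k = 0" if "i < k" "k < d"
    unfolding expand[OF that(2)]
  proof (rule sum.neutral, rule ballI)
    fix j assume "j \<in> {0..<d}"
    then consider "j < k" | "i < j" "j < d" using \<open>i < k\<close> by fastforce
    then show "T $$ (k, j) * u $ j = 0"
      using upper_triangularD[OF assms(2), of j k] assms(1) that zero by cases auto
  qed
qed

text \<open>
  In the triangularizing basis the entries of an eigenvector for an eigenvalue \<open>c \<noteq> 0\<close> vanish one
  after the other, from the last to the first.
\<close>
lemma triangularizable_commutator_no_eigenvector: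
  fixes v :: "complex Matrix.vec"
  assumes tri: "simultaneously_triangularizable d M N" and v: "v \<in> carrier_vec d"
    and eig: "M *\<^sub>v (N *\<^sub>v v) - N *\<^sub>v (M *\<^sub>v v) = c \<cdot>\<^sub>v v" and c: "c \<noteq> 0"
  shows "v = 0\<^sub>v d"
proof -
  from tri obtain U where M: "M \<in> carrier_mat d d" and N: "N \<in> carrier_mat d d"
    and U: "U \<in> carrier_mat d d" and UA: "U * mat_adjoint U = 1\<^sub>m d"
    and triM: "upper_triangular (mat_adjoint U * M * U)"
    and triN: "upper_triangular (mat_adjoint U * N * U)"
    unfolding simultaneously_triangularizable_def unitary_mat_def by auto
  define A where "A = mat_adjoint U"
  have A: "A \<in> carrier_mat d d" using U unfolding A_def mat_adjoint_def by auto
  have UA_vec: "U *\<^sub>v (A *\<^sub>v x) = x" if "x \<in> carrier_vec d" for x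
    using assoc_mult_mat_vec[OF U A that] UA that by (simp add: A_def)
  have conjugated: "(A * L * U) *\<^sub>v (A *\<^sub>v x) = A *\<^sub>v (L *\<^sub>v x)"
    if L: "L \<in> carrier_mat d d" and x: "x \<in> carrier_vec d" for L x
  proof -
    have Ax: "A *\<^sub>v x \<in> carrier_vec d" using A x by simp
    have "(A * L * U) *\<^sub>v (A *\<^sub>v x) = (A * L) *\<^sub>v (U *\<^sub>v (A *\<^sub>v x))"
      using A L U Ax by (intro assoc_mult_mat_vec) auto
    also have "\<dots> = A *\<^sub>v (L *\<^sub>v x)"
      unfolding UA_vec[OF x] using A L x by (intro assoc_mult_mat_vec) auto
    finally show ?thesis .
  qed
  let ?M = "A * M * U" and ?N = "A * N * U"
  have M': "?M \<in> carrier_mat d d" and N': "?N \<in> carrier_mat d d" using A M N U by auto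
  define u where "u = A *\<^sub>v v"
  have u: "u \<in> carrier_vec d" using A v by (simp add: u_def)
  have "?M *\<^sub>v (?N *\<^sub>v u) - ?N *\<^sub>v (?M *\<^sub>v u) = A *\<^sub>v (M *\<^sub>v (N *\<^sub>v v)) - A *\<^sub>v (N *\<^sub>v (M *\<^sub>v v))"
    unfolding u_def using M N v by (simp add: conjugated)
  also have "\<dots> = A *\<^sub>v (c \<cdot>\<^sub>v v)"
    unfolding eig[symmetric] using A M N v by (intro mult_minus_distrib_mat_vec[symmetric]) auto
  also have "\<dots> = c \<cdot>\<^sub>v u" unfolding u_def using A v by (intro mult_mat_vec) auto
  finally have eig_u: "?M *\<^sub>v (?N *\<^sub>v u) - ?N *\<^sub>v (?M *\<^sub>v u) = c \<cdot>\<^sub>v u" .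
  have "i < d \<longrightarrow> u $ i = 0" for i
  proof (induction "d - i" arbitrary: i rule: less_induct)
    case less
    show ?case
    proof
      assume i: "i < d"
      have zero: "u $ j = 0" if "i < j" "j < d" for j using less[of j] that by simp
      note mult_M = upper_triangular_mult_vec[OF M' triM[folded A_def] _ i]
        and mult_N = upper_triangular_mult_vec[OF N' triN[folded A_def] _ i]
      have Mu: "?M *\<^sub>v u \<in> carrier_vec d" and Nu: "?N *\<^sub>v u \<in> carrier_vec d"
        using M' N' u by auto
      have "c * u $ i = (?M *\<^sub>v (?N *\<^sub>v u)) $ i - (?N *\<^sub>v (?M *\<^sub>v u)) $ i"
        using arg_cong[OF eig_u, of "\<lambda>w. w $ i"] i u A M' N'
        by (simp del: index_mult_mat_vec)
      also have "\<dots> = 0"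
        using mult_M(1)[OF Nu mult_N(2)[OF u zero]] mult_M(1)[OF u zero]
          mult_N(1)[OF Mu mult_M(2)[OF u zero]] mult_N(1)[OF u zero]
        by (simp del: index_mult_mat_vec)
      finally show "u $ i = 0" using c by simp
    qed
  qed
  then have "u = 0\<^sub>v d" using u by (intro eq_vecI) auto
  then have "v = U *\<^sub>v 0\<^sub>v d" using UA_vec[OF v] by (simp add: u_def)
  then show ?thesis using U by (intro eq_vecI) (auto simp: scalar_prod_def)
qed

section \<open>Truncations of the commutator of two operators\<close>

text \<open>
  There is no projection to the right of \<open>C\<close> and \<open>Z\<close>.  This is enough for the eigenvalues, as an
  eigenvector for a nonzero eigenvalue lies in the range of the projection, and norm convergence then
  follows from the approximation of the compact operators by left projections alone, without adjoints.
\<close>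
definition truncated_commutator ::
    "(nat \<Rightarrow> 'a::chilbert_space) \<Rightarrow> ('a \<Rightarrow> 'a) \<Rightarrow> ('a \<Rightarrow> 'a) \<Rightarrow> nat \<Rightarrow> 'a \<Rightarrow> 'a"
  where "truncated_commutator f C Z d x =
    proj f d (C (proj f d (Z x))) - proj f d (Z (proj f d (C x)))"

lemma corner_mult_coordinates:
  assumes "bounded_operator T"
  shows "corner f T d *\<^sub>v vec d (\<lambda>j. cinner (f j) y) = vec d (\<lambda>i. cinner (f i) (T (proj f d y)))"
  by (rule eq_vecI)
     (auto simp: corner_def scalar_prod_def matrix_entry_def proj_def bounded_operator_simps[OF assms]
        cinner_sum_right cinner_scaleC_right atLeast0LessThan mult.commute)

lemma truncated_commutator_no_eigenvector:
  fixes f :: "nat \<Rightarrow> 'a::chilbert_space"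
  assumes onb: "orthonormal_basis f" and C: "bounded_operator C" and Z: "bounded_operator Z"
    and tri: "simultaneously_triangularizable d (corner f C d) (corner f Z d)"
    and c: "c \<noteq> 0" and eig: "truncated_commutator f C Z d x = scaleC c x"
  shows "x = 0"
proof -
  note P = bounded_operator_proj[OF onb, of d]
  have "proj f d (scaleC c x) = scaleC c x"
    unfolding eig[symmetric] truncated_commutator_def
    by (simp add: bounded_operator_simps[OF P] proj_proj[OF onb])
  then have Px: "proj f d x = x" using c by (simp add: bounded_operator_simps[OF P])
  define v where "v = vec d (\<lambda>i. cinner (f i) x)"
  have "corner f C d *\<^sub>v (corner f Z d *\<^sub>v v) - corner f Z d *\<^sub>v (corner f C d *\<^sub>v v) = c \<cdot>\<^sub>v v"
  proof (rule eq_vecI)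
    fix i assume "i < dim_vec (c \<cdot>\<^sub>v v)"
    then have i: "i < d" by (simp add: v_def)
    have "cinner (f i) (C (proj f d (Z x))) - cinner (f i) (Z (proj f d (C x))) =
        cinner (f i) (truncated_commutator f C Z d x)"
      using i by (simp add: truncated_commutator_def cinner_diff_right cinner_basis_proj[OF onb])
    then show "(corner f C d *\<^sub>v (corner f Z d *\<^sub>v v) - corner f Z d *\<^sub>v (corner f C d *\<^sub>v v)) $ i =
        (c \<cdot>\<^sub>v v) $ i"
      using i
      by (simp add: v_def corner_mult_coordinates[OF C] corner_mult_coordinates[OF Z] Px eig
          cinner_scaleC_right del: index_mult_mat_vec)
  qed (simp add: v_def corner_def)
  from triangularizable_commutator_no_eigenvector[OF tri _ this c]
  have "v = 0\<^sub>v d" by (simp add: v_def)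
  then have "cinner (f i) x = 0" if "i < d" for i
  proof -
    have "v $ i = 0" using \<open>v = 0\<^sub>v d\<close> that by simp
    then show ?thesis using that by (simp add: v_def)
  qed
  then have "proj f d x = 0" by (simp add: proj_def)
  with Px show "x = 0" by simp
qed

lemma truncated_commutator_limit:
  fixes f :: "nat \<Rightarrow> 'a::chilbert_space"
  assumes onb: "orthonormal_basis f" and C: "compact_operator C" and Z: "compact_operator Z"
  shows "operator_limit (truncated_commutator f C Z) (\<lambda>x. C (Z x) - Z (C x))"
  unfolding operator_limit_def
proof (intro allI impI)
  fix e :: real assume e: "e > 0"
  have bC: "bounded_operator C" and bZ: "bounded_operator Z"
    using C Z by (auto simp: compact_operator_def)
  obtain B where B: "B > 0" "\<And>x. norm (C x) \<le> B * norm x" using bounded_operator_bound[OF bC] by blast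
  obtain D where D: "D > 0" "\<And>x. norm (Z x) \<le> D * norm x" using bounded_operator_bound[OF bZ] by blast
  define d where "d = e / (2 * (B + D))"
  have d: "d > 0" using e B(1) D(1) by (simp add: d_def)
  obtain m1 where m1: "\<And>n x. n \<ge> m1 \<Longrightarrow> norm (C x - proj f n (C x)) \<le> d * norm x"
    using compact_operator_proj_approx[OF onb C d] by blast
  obtain m2 where m2: "\<And>n x. n \<ge> m2 \<Longrightarrow> norm (Z x - proj f n (Z x)) \<le> d * norm x"
    using compact_operator_proj_approx[OF onb Z d] by blast
  \<comment> \<open>Both projections stand to the left of a compact operator, where they converge in norm.\<close>
  have product: "norm (S (T x) - proj f n (S (proj f n (T x)))) \<le> d * (K + L) * norm x"
    if S: "bounded_operator S" and S_bound: "\<And>x. norm (S x) \<le> K * norm x" and K: "K > 0"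
      and T_bound: "\<And>x. norm (T x) \<le> L * norm x"
      and S_approx: "\<And>x. norm (S x - proj f n (S x)) \<le> d * norm x"
      and T_approx: "\<And>x. norm (T x - proj f n (T x)) \<le> d * norm x" for S T K L n x
  proof -
    have "S (T x) - proj f n (S (proj f n (T x))) =
        (S (T x) - proj f n (S (T x))) + proj f n (S (T x - proj f n (T x)))"
      by (simp add: bounded_operator_simps[OF S] bounded_operator_simps[OF bounded_operator_proj[OF onb]])
    also have "norm \<dots> \<le> d * norm (T x) + K * norm (T x - proj f n (T x))"
      by (intro norm_triangle_le add_mono S_approx order_trans[OF norm_proj_le[OF onb] S_bound])
    also have "\<dots> \<le> d * (L * norm x) + K * (d * norm x)"
      using d K by (intro add_mono mult_left_mono T_bound T_approx) auto
    finally show ?thesis by (simp add: algebra_simps)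
  qed
  have "norm (truncated_commutator f C Z n x - (C (Z x) - Z (C x))) \<le> e * norm x"
    if n: "n \<ge> max m1 m2" for n x
  proof -
    have "truncated_commutator f C Z n x - (C (Z x) - Z (C x)) =
        (Z (C x) - proj f n (Z (proj f n (C x)))) - (C (Z x) - proj f n (C (proj f n (Z x))))"
      by (simp add: truncated_commutator_def)
    also have "norm \<dots> \<le> d * (D + B) * norm x + d * (B + D) * norm x"
      using n by (intro order_trans[OF norm_triangle_ineq4] add_mono product bC bZ B D m1 m2) auto
    also have "\<dots> = (2 * (B + D) * d) * norm x" by (simp add: algebra_simps)
    also have "\<dots> = e * norm x" using B(1) D(1) by (simp add: d_def)
    finally show ?thesis .
  qed
  then show "\<exists>m. \<forall>n\<ge>m. \<forall>x. norm (truncated_commutator f C Z n x - (C (Z x) - Z (C x))) \<le> e * norm x"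
    by blast
qed

text \<open>
  The truncations take values in the range of \<open>P\<^sub>n\<close>, so \<open>I - P\<^sub>n\<close> sees only the difference between the
  commutator and its truncation.
\<close>
lemma tail_commutator_approx:
  fixes f :: "nat \<Rightarrow> 'a::chilbert_space"
  assumes onb: "orthonormal_basis f" and C: "compact_operator C" and Z: "compact_operator Z"
    and e: "e > 0"
  shows "\<exists>N. \<forall>x. norm (tail f N (\<lambda>x. C (Z x) - Z (C x)) x) \<le> e * norm x"
proof -
  obtain n where n: "\<And>x. norm (truncated_commutator f C Z n x - (C (Z x) - Z (C x))) \<le> e * norm x"
    using truncated_commutator_limit[OF onb C Z] e unfolding operator_limit_def by blast
  have "norm (tail f n (\<lambda>x. C (Z x) - Z (C x)) x) \<le> e * norm x" for x
  proof -
    let ?K = "C (Z x) - Z (C x)" and ?T = "truncated_commutator f C Z n x"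
    have "proj f n ?T = ?T"
      by (simp add: truncated_commutator_def bounded_operator_simps[OF bounded_operator_proj[OF onb]]
          proj_proj[OF onb])
    then have "tail f n (\<lambda>x. C (Z x) - Z (C x)) x = (?K - ?T) - proj f n (?K - ?T)"
      by (simp add: tail_def bounded_operator_simps[OF bounded_operator_proj[OF onb]])
    then have "norm (tail f n (\<lambda>x. C (Z x) - Z (C x)) x) \<le> norm (?K - ?T)"
      using norm_diff_proj_le[OF onb] by metis
    then show ?thesis using n[of x] by (simp add: norm_minus_commute)
  qed
  then show ?thesis by blast
qed

theorem theorem2p1:
  fixes f :: "nat \<Rightarrow> 'a::chilbert_space"
    and C Z :: "'a \<Rightarrow> 'a"
    and Cb A B Zb X Y :: "nat \<Rightarrow> complex mat"
  assumes "orthonormal_basis f"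
    and "compact_operator C" and "compact_operator Z"
    and "block_tridiagonal f C Cb A B"
    and "block_tridiagonal f Z Zb X Y"
    and "\<And>n. n \<ge> 1 \<Longrightarrow>
      simultaneously_triangularizable (5 ^ (n - 1))
        (corner f C (5 ^ (n - 1))) (corner f Z (5 ^ (n - 1)))"
  shows "quasinilpotent (\<lambda>x. C (Z x) - Z (C x))"
proof -
  let ?K = "\<lambda>x. C (Z x) - Z (C x)"
  let ?Kn = "\<lambda>n. truncated_commutator f C Z (5 ^ n)"
  note onb = assms(1)
  have C: "bounded_operator C" and Z: "bounded_operator Z"
    using assms(2,3) by (auto simp: compact_operator_def)
  have K: "bounded_operator ?K"
    by (rule bounded_operator_diff[OF bounded_operator_compose[OF C Z] bounded_operator_compose[OF Z C]])
  have Kn: "bounded_operator (?Kn n)" for n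
    unfolding truncated_commutator_def
    by (intro bounded_operator_diff
        bounded_operator_compose[OF bounded_operator_proj[OF onb]]
        bounded_operator_compose[OF C] bounded_operator_compose[OF Z] C Z)
  note approx = tail_commutator_approx[OF assms(1-3)]
  have lim: "operator_limit ?Kn ?K"
    unfolding operator_limit_def
  proof (intro allI impI)
    fix e :: real assume "e > 0"
    then obtain m where m: "\<forall>n\<ge>m. \<forall>x. norm (truncated_commutator f C Z n x - ?K x) \<le> e * norm x"
      using truncated_commutator_limit[OF assms(1-3)] unfolding operator_limit_def by blast
    have "m \<le> 5 ^ n" if "n \<ge> m" for n :: nat
      using that less_exp[of n] power_mono[of 2 "5::nat" n] by linarith
    with m show "\<exists>m. \<forall>n\<ge>m. \<forall>x. norm (?Kn n x - ?K x) \<le> e * norm x" by blast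
  qed
  have no_eig: "x = 0" if "c \<noteq> 0" "?Kn n x = scaleC c x" for n c x
    using truncated_commutator_no_eigenvector[OF onb C Z _ that] assms(6)[of "Suc n"] by simp
  have "c \<notin> operator_spectrum ?K" if "c \<noteq> 0" for c
    by (rule limit_no_eigenvalue_imp_notin_spectrum[OF onb K Kn _ lim _ that])
       (erule approx | erule (1) no_eig)+
  moreover have "0 \<in> operator_spectrum ?K"
    by (rule zero_in_operator_spectrum[OF onb K]) (erule approx)
  ultimately have "operator_spectrum ?K = {0}" by blast
  with K show ?thesis by (simp add: quasinilpotent_def)
qed

end
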